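(* Let $\Sigma=\{\mathtt{a},\mathtt{b}\}$, let $k\in\mathbb{N}$ and let $w,w'\in\Sigma^*$ with $m\coloneqq\iota(w)=\iota(w')<k$, with $\alpha$-$\beta$-factorizations $w=\alpha_0\beta_1\alpha_1\cdots\beta_m\alpha_m$ and $w'=\alpha_0'\beta_1'\alpha_1'\cdots\beta_m'\alpha_m'$. Then $w\sim_k w'$ if and only if $\beta_i=\beta_i'$ for all $i\in\{1,\dots,m\}$ and $\alpha_i\sim_{k-m}\alpha_i'$ for all $i\in\{0,\dots,m\}$.
   Context: A word $u$ is a scattered factor of $w$ if $u$ is obtained from $w$ by deleting some letters (keeping order). For $k\in\mathbb{N}_0$, $u\sim_k v$ iff $u$ and $v$ have exactly the same scattered factors of length at most $k$. $\iota(w)$ is the largest $\ell$ such that every word of $\Sigma^\ell$ is a scattered factor of $w$. The arch factorization of $w$ is the unique factorization $w=\mathrm{ar}_1(w)\cdots\mathrm{ar}_\ell(w)\mathrm{re}(w)$ where each arch $\mathrm{ar}_i(w)$ contains every letter of $\Sigma$ and its last letter occurs exactly once in it, and $\mathrm{re}(w)$ does not contain every letter of $\Sigma$; $\ell=\iota(w)$. With $w^R$ the reversal, $\mathrm{ra}_i(w)\coloneqq(\mathrm{ar}_{\iota(w)-i+1}(w^R))^R$ and $\mathrm{er}(w)\coloneqq(\mathrm{re}(w^R))^R$. The $\alpha$-$\beta$-factorization of $w$ is $w=\alpha_0\beta_1\alpha_1\cdots\beta_{\iota(w)}\alpha_{\iota(w)}$ with $\mathrm{ar}_i(w)=\alpha_{i-1}\beta_i$,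 $\mathrm{ra}_i(w)=\beta_i\alpha_i$ for all $i\in\{1,\dots,\iota(w)\}$, $\alpha_0=\mathrm{er}(w)$, $\alpha_{\iota(w)}=\mathrm{re}(w)$. *)

theory Defs
  imports Main "HOL-Library.Sublist"
begin

text \<open>A word \<open>u\<close> is a scattered factor of \<open>w\<close> iff \<open>subseq u w\<close>.\<close>

definition scatfacts_upto :: "nat \<Rightarrow> 'a list \<Rightarrow> 'a list set" where
  "scatfacts_upto k w = {u. subseq u w \<and> length u \<le> k}"

definition simon_congruent :: "nat \<Rightarrow> 'a list \<Rightarrow> 'a list \<Rightarrow> bool" where
  "simon_congruent k u v \<longleftrightarrow> scatfacts_upto k u = scatfacts_upto k v"

definition iota :: "'a set \<Rightarrow> 'a list \<Rightarrow> nat" where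
  "iota \<Sigma> w = (GREATEST l. \<forall>u \<in> lists \<Sigma>. length u = l \<longrightarrow> subseq u w)"

definition is_arch :: "'a set \<Rightarrow> 'a list \<Rightarrow> bool" where
  "is_arch \<Sigma> x \<longleftrightarrow> x \<noteq> [] \<and> \<Sigma> \<subseteq> set x \<and> count_list x (last x) = 1"

definition is_arch_factorization :: "'a set \<Rightarrow> 'a list \<Rightarrow> 'a list list \<times> 'a list \<Rightarrow> bool" where
  "is_arch_factorization \<Sigma> w p \<longleftrightarrow>
     w = concat (fst p) @ snd p \<and> (\<forall>x \<in> set (fst p). is_arch \<Sigma> x) \<and> \<not> \<Sigma> \<subseteq> set (snd p)"

lemma is_arch_unique:
  assumes "is_arch \<Sigma> x" "is_arch \<Sigma> y" "x @ u = y @ v" "set x \<subseteq> \<Sigma>" "set y \<subseteq> \<Sigma>"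
  shows "x = y"
proof -
  have *: "z = []" if "is_arch \<Sigma> (y @ z)" "is_arch \<Sigma> y" "set (y @ z) \<subseteq> \<Sigma>" for y z :: "'a list"
  proof (rule ccontr)
    assume "z \<noteq> []"
    then have l: "last (y @ z) \<in> set z" by simp
    with that have "last (y @ z) \<in> set y" by (auto simp: is_arch_def)
    with l have "count_list y (last (y @ z)) \<noteq> 0" "count_list z (last (y @ z)) \<noteq> 0"
      by (metis count_list_0_iff)+
    with that(1) show False by (simp add: is_arch_def del: last_append)
  qed
  from assms(3) obtain z where "x = y @ z \<or> y = x @ z"
    by (auto simp: append_eq_append_conv2)
  with *[of y z] *[of x z] assms show ?thesis by auto
qed

lemma arch_factorization_unique:
  assumes "w \<in> lists \<Sigma>" "is_arch_factorization \<Sigma> w (xs, r)" "is_arch_factorization \<Sigma> w (ys, s)"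
  shows "xs = ys \<and> r = s"
  using assms
proof (induction xs arbitrary: w ys)
  case Nil
  then show ?case by (cases ys) (auto simp: is_arch_factorization_def is_arch_def)
next
  case (Cons x xs)
  then obtain y ys' where ys: "ys = y # ys'"
    by (cases ys) (auto simp: is_arch_factorization_def is_arch_def)
  from Cons.prems ys have w: "w = x @ concat xs @ r" "w = y @ concat ys' @ s"
    and arch: "is_arch \<Sigma> x" "is_arch \<Sigma> y"
    by (auto simp: is_arch_factorization_def)
  have sub: "set w \<subseteq> \<Sigma>" using Cons.prems(1) by auto
  have "set x \<subseteq> \<Sigma>" using sub unfolding w(1) by simp
  moreover have "set y \<subseteq> \<Sigma>" using sub unfolding w(2) by simp
  ultimately have xy: "x = y" using is_arch_unique[OF arch] w by metis
  have "concat xs @ r \<in> lists \<Sigma>" using Cons.prems(1) unfolding w(1) by simp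
  moreover have "is_arch_factorization \<Sigma> (concat xs @ r) (xs, r)"
    using Cons.prems(2) by (simp add: is_arch_factorization_def)
  moreover have "is_arch_factorization \<Sigma> (concat xs @ r) (ys', s)"
    using Cons.prems(3) w xy ys by (simp add: is_arch_factorization_def)
  ultimately show ?case using Cons.IH xy ys by blast
qed

lemma arch_prefix_exists:
  assumes "\<Sigma> \<noteq> {}" "\<Sigma> \<subseteq> set w"
  shows "\<exists>x v. w = x @ v \<and> is_arch \<Sigma> x"
  using assms(2)
proof (induction w rule: rev_induct)
  case Nil
  with assms(1) show ?case by simp
next
  case (snoc c w)
  show ?case
  proof (cases "\<Sigma> \<subseteq> set w")
    case True
    with snoc.IH show ?thesis by (metis append.assoc)
  next
    case False
    with snoc.prems have "c \<notin> set w" by auto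
    with snoc.prems have "is_arch \<Sigma> (w @ [c])" by (simp add: is_arch_def)
    then show ?thesis by blast
  qed
qed

lemma arch_factorization_exists:
  assumes "\<Sigma> \<noteq> {}"
  shows "\<exists>p. is_arch_factorization \<Sigma> w p"
proof (induction "length w" arbitrary: w rule: less_induct)
  case less
  show ?case
  proof (cases "\<Sigma> \<subseteq> set w")
    case True
    with arch_prefix_exists[OF assms] obtain x v where xv: "w = x @ v" "is_arch \<Sigma> x" by blast
    then have "length v < length w" by (simp add: is_arch_def)
    with less obtain p where "is_arch_factorization \<Sigma> v p" by blast
    with xv have "is_arch_factorization \<Sigma> w (x # fst p, snd p)"
      by (simp add: is_arch_factorization_def)
    then show ?thesis by blast
  next
    case False
    then have "is_arch_factorization \<Sigma> w ([], w)" by (simp add: is_arch_factorization_def)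
    then show ?thesis by blast
  qed
qed

lemma arch_factorization_ex1:
  assumes "\<Sigma> \<noteq> {}" "w \<in> lists \<Sigma>"
  shows "\<exists>!p. is_arch_factorization \<Sigma> w p"
  using arch_factorization_exists[OF assms(1), of w] arch_factorization_unique[OF assms(2)]
  by (metis prod.collapse)

definition arch_factorization :: "'a set \<Rightarrow> 'a list \<Rightarrow> 'a list list \<times> 'a list" where
  "arch_factorization \<Sigma> w = (THE p. is_arch_factorization \<Sigma> w p)"

text \<open>Arches are indexed from 1.\<close>

definition ar :: "'a set \<Rightarrow> nat \<Rightarrow> 'a list \<Rightarrow> 'a list" where
  "ar \<Sigma> i w = fst (arch_factorization \<Sigma> w) ! (i - 1)"

definition re :: "'a set \<Rightarrow> 'a list \<Rightarrow> 'a list" where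
  "re \<Sigma> w = snd (arch_factorization \<Sigma> w)"

definition ra :: "'a set \<Rightarrow> nat \<Rightarrow> 'a list \<Rightarrow> 'a list" where
  "ra \<Sigma> i w = rev (ar \<Sigma> (iota \<Sigma> w - i + 1) (rev w))"

definition er :: "'a set \<Rightarrow> 'a list \<Rightarrow> 'a list" where
  "er \<Sigma> w = rev (re \<Sigma> (rev w))"

text \<open>Only the values \<open>\<alpha> i\<close> for \<open>i \<le> iota \<Sigma> w\<close> and \<open>\<beta> i\<close> for \<open>1 \<le> i \<le> iota \<Sigma> w\<close> matter.\<close>

definition is_alpha_beta_factorization ::
  "'a set \<Rightarrow> 'a list \<Rightarrow> (nat \<Rightarrow> 'a list) \<Rightarrow> (nat \<Rightarrow> 'a list) \<Rightarrow> bool" where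
  "is_alpha_beta_factorization \<Sigma> w \<alpha> \<beta> \<longleftrightarrow>
     w = \<alpha> 0 @ concat (map (\<lambda>i. \<beta> i @ \<alpha> i) [1..<Suc (iota \<Sigma> w)]) \<and>
     (\<forall>i \<in> {1..iota \<Sigma> w}. ar \<Sigma> i w = \<alpha> (i - 1) @ \<beta> i \<and> ra \<Sigma> i w = \<beta> i @ \<alpha> i) \<and>
     \<alpha> 0 = er \<Sigma> w \<and> \<alpha> (iota \<Sigma> w) = re \<Sigma> w"

end

theory Submission imports Defs begin

text \<open>
  For the backward direction, the prefix before \<open>\<alpha>\<^sub>i\<close> contains all words of length \<open>i\<close> and the
  suffix after it all words of length \<open>m - i\<close>. So a scattered factor of length at most \<open>k\<close> can be
  embedded with at most \<open>k - m\<close> letters in \<open>\<alpha>\<^sub>i\<close>, and the \<open>\<alpha>\<^sub>i\<close> can be exchanged one by one.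

  The forward direction is by induction on \<open>m\<close>. If the first arches of \<open>w = x v\<close> and \<open>w' = x' v'\<close>
  end with the same letter, then cancelling that letter gives \<open>v \<sim> v'\<close> for \<open>k - 1\<close>. Otherwise
  cancelling each of the two letters yields \<open>v \<sim> y v\<close> for \<open>k - 1\<close> with a word \<open>y\<close> containing both
  letters, which contradicts \<open>\<iota>(v) < k - 1\<close>. Afterwards \<open>\<beta>\<^sub>1\<close> is determined by the last letter of the
  first arch and the letters of \<open>\<alpha>\<^sub>1\<close>, and \<open>\<alpha>\<^sub>0\<close> is recovered by appending the first letters of all
  \<open>\<beta>\<^sub>i\<close> to its scattered factors.
\<close>

section \<open>Scattered factors\<close>

lemma subseq_rev_iff: "subseq (rev u) (rev v) \<longleftrightarrow> subseq u v"
proof -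
  have *: "subseq (rev u) (rev v)" if "subseq u v" for u v :: "'a list"
    using that by induction (auto intro: list_emb_append_mono)
  show ?thesis using *[of u v] *[of "rev u" "rev v"] by auto
qed

text \<open>Greedy matching: the displayed \<open>y\<close> is the first one available, so the
  leading letter may always be sent there, and exactly \<open>v\<close> is left for
  \<open>u\<close>.\<close>

lemma subseq_Cons_first_occurrence:
  assumes "y \<notin> set s"
  shows "subseq (y # u) (s @ y # v) \<longleftrightarrow> subseq u v"
  using assms by (induction s) auto

lemma subseq_snoc_last_occurrence:
  assumes "c \<notin> set r"
  shows "subseq (u @ [c]) (v @ c # r) \<longleftrightarrow> subseq u v"
proof -
  have "subseq (u @ [c]) (v @ c # r) \<longleftrightarrow> subseq (c # rev u) (rev r @ c # rev v)"
    by (subst subseq_rev_iff[symmetric]) simp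
  also have "\<dots> \<longleftrightarrow> subseq u v"
    using assms by (simp add: subseq_Cons_first_occurrence subseq_rev_iff)
  finally show ?thesis .
qed

lemma subseq_set: "subseq u v \<Longrightarrow> set u \<subseteq> set v"
  by (induction rule: list_emb.induct) auto

lemma simon_congruent_iff:
  "simon_congruent k u v \<longleftrightarrow> (\<forall>x. length x \<le> k \<longrightarrow> subseq x u = subseq x v)"
  by (auto simp: simon_congruent_def scatfacts_upto_def)

lemma simon_congruent_sym: "simon_congruent k u v \<Longrightarrow> simon_congruent k v u"
  by (simp add: simon_congruent_def)

lemma simon_congruent_subseq:
  "simon_congruent k u v \<Longrightarrow> subseq x u \<Longrightarrow> length x \<le> k \<Longrightarrow> subseq x v"
  by (simp add: simon_congruent_iff)

lemma simon_congruent_set_eq: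
  assumes "simon_congruent k u v" "0 < k"
  shows "set u = set v"
proof -
  have "c \<in> set u \<longleftrightarrow> c \<in> set v" for c
    using assms by (auto simp: simon_congruent_iff subseq_singleton_left dest: spec[of _ "[c]"])
  then show ?thesis by blast
qed

text \<open>Test words of the form \<open>y # x\<close> see only what follows the first
  \<open>y\<close>; that leading letter costs one in the length bound.\<close>

lemma simon_congruent_cancel:
  assumes "simon_congruent (Suc k) (s @ y # v) (s' @ y # v')" "y \<notin> set s" "y \<notin> set s'"
  shows "simon_congruent k v v'"
  unfolding simon_congruent_iff
proof (intro allI impI)
  fix x :: "'a list" assume "length x \<le> k"
  then have "subseq (y # x) (s @ y # v) = subseq (y # x) (s' @ y # v')"
    using assms(1) by (simp add: simon_congruent_iff)
  then show "subseq x v = subseq x v'"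
    by (simp only: subseq_Cons_first_occurrence[OF assms(2)] subseq_Cons_first_occurrence[OF assms(3)])
qed

section \<open>Universality\<close>

text \<open>This is the predicate under \<open>GREATEST\<close> in \<open>iota\<close>, named so
  that it can be used before the maximum is known to exist.\<close>

definition universal :: "'a set \<Rightarrow> nat \<Rightarrow> 'a list \<Rightarrow> bool" where
  "universal \<Sigma> l w \<longleftrightarrow> (\<forall>u \<in> lists \<Sigma>. length u = l \<longrightarrow> subseq u w)"

lemma universal_0 [simp]: "universal \<Sigma> 0 w"
  by (simp add: universal_def)

lemma universal_subseq_le:
  assumes "universal \<Sigma> l w" "u \<in> lists \<Sigma>" "length u \<le> l"
  shows "subseq u w"
proof (cases "u = []")
  case False
  \<comment> \<open>Padding with a letter of \<open>u\<close> itself keeps the word over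
    \<open>\<Sigma>\<close>.\<close>
  let ?v = "u @ replicate (l - length u) (hd u)"
  have "hd u \<in> \<Sigma>" using False assms(2) by (cases u) auto
  then have "?v \<in> lists \<Sigma>" using assms(2) by (auto simp: in_lists_conv_set)
  moreover have "length ?v = l" using assms(3) by simp
  ultimately have "subseq ?v w" using assms(1) unfolding universal_def by blast
  moreover have "subseq u ?v" by (intro list_emb_prefix subseq_order.order_refl)
  ultimately show ?thesis by (metis subseq_order.order_trans)
qed simp

lemma universal_mono: "universal \<Sigma> l w \<Longrightarrow> n \<le> l \<Longrightarrow> universal \<Sigma> n w"
  using universal_subseq_le unfolding universal_def by blast

lemma universal_append:
  assumes "universal \<Sigma> p x" "universal \<Sigma> q y"
  shows "universal \<Sigma> (p + q) (x @ y)"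
  unfolding universal_def
proof (intro ballI impI)
  fix u assume u: "u \<in> lists \<Sigma>" "length u = p + q"
  then have "take p u \<in> lists \<Sigma>" "drop p u \<in> lists \<Sigma>"
    by (auto simp: in_lists_conv_set dest: in_set_takeD in_set_dropD)
  then have "subseq (take p u) x" "subseq (drop p u) y"
    using assms u(2) unfolding universal_def by simp_all
  then have "subseq (take p u @ drop p u) (x @ y)" by (rule list_emb_append_mono)
  then show "subseq u (x @ y)" by simp
qed

lemma universal_1: "\<Sigma> \<subseteq> set x \<Longrightarrow> universal \<Sigma> 1 x"
  by (auto simp: universal_def length_Suc_conv subseq_singleton_left)

lemma universal_rev: "universal \<Sigma> l (rev w) \<longleftrightarrow> universal \<Sigma> l w"
proof -
  have *: "universal \<Sigma> l (rev w)" if "universal \<Sigma> l w" for w :: "'a list"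
    unfolding universal_def
  proof (intro ballI impI)
    fix u assume "u \<in> lists \<Sigma>" "length u = l"
    then have "subseq (rev u) w" using that unfolding universal_def by (simp add: in_lists_conv_set)
    then show "subseq u (rev w)" by (metis subseq_rev_iff rev_rev_ident)
  qed
  show ?thesis using *[of w] *[of "rev w"] by auto
qed

text \<open>If an embedding places fewer than \<open>p\<close> letters in \<open>x\<close>, the
  first \<open>p\<close> letters of \<open>u\<close> can be put there instead by universality; what
  remains is a suffix of the part already embedded in \<open>y\<close>.\<close>

lemma subseq_append_long_prefix:
  assumes "universal \<Sigma> p x" "u \<in> lists \<Sigma>" "p \<le> length u" "subseq u (x @ y)"
  obtains u1 u2 where "u = u1 @ u2" "p \<le> length u1" "subseq u1 x" "subseq u2 y"
proof -
  from assms(4) obtain v1 v2 where v: "u = v1 @ v2" "subseq v1 x" "subseq v2 y"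
    by (rule subseq_appendE)
  show ?thesis
  proof (cases "p \<le> length v1")
    case True
    with v that show ?thesis by blast
  next
    case False
    have "take p u \<in> lists \<Sigma>" using assms(2) by (auto simp: in_lists_conv_set dest: in_set_takeD)
    then have "subseq (take p u) x" using assms(1,3) unfolding universal_def by simp
    moreover have "subseq (drop p u) y"
    proof -
      have "drop p u = drop (p - length v1) v2" using v(1) False by simp
      then have "subseq (drop p u) v2" by (metis suffix_drop suffix_imp_subseq)
      with v(3) show ?thesis by (metis subseq_order.order_trans)
    qed
    ultimately show ?thesis using that[of "take p u" "drop p u"] assms(3) by simp
  qed
qed

lemma subseq_append_long_suffix:
  assumes "universal \<Sigma> q y" "u \<in> lists \<Sigma>" "q \<le> length u" "subseq u (x @ y)"
  obtains u1 u2 where "u = u1 @ u2" "q \<le> length u2" "subseq u1 x" "subseq u2 y"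
proof -
  have "universal \<Sigma> q (rev y)" "rev u \<in> lists \<Sigma>" "q \<le> length (rev u)" "subseq (rev u) (rev y @ rev x)"
    using assms by (auto simp: universal_rev subseq_rev_iff simp flip: rev_append)
  then obtain v1 v2 where "rev u = v1 @ v2" "q \<le> length v1" "subseq v1 (rev y)" "subseq v2 (rev x)"
    by (rule subseq_append_long_prefix)
  then have "u = rev v2 @ rev v1 \<and> q \<le> length (rev v1) \<and> subseq (rev v2) x \<and> subseq (rev v1) y"
    by (metis length_rev rev_append rev_rev_ident subseq_rev_iff)
  then show ?thesis using that by blast
qed

text \<open>A long \<open>u\<close> can be split so that \<open>P\<close> takes at least
  \<open>p\<close> letters and \<open>S\<close> at least \<open>q\<close>, leaving at most
  \<open>d\<close> for \<open>x\<close>, where the congruence applies. If there are too few letters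
  for such a split, \<open>P\<close> or \<open>S\<close> takes all that are left.\<close>

lemma subseq_replace_between_universal:
  assumes P: "universal \<Sigma> p P" and S: "universal \<Sigma> q S" and xy: "simon_congruent d x y"
    and u: "u \<in> lists \<Sigma>" "length u \<le> p + q + d" "subseq u (P @ x @ S)"
  shows "subseq u (P @ y @ S)"
proof (cases "p \<le> length u")
  case False
  then have "subseq u P" using universal_subseq_le[OF P u(1)] by simp
  then show ?thesis by (simp add: list_emb_prefix)
next
  case True
  obtain u1 u2 where u12: "u = u1 @ u2" "p \<le> length u1" "subseq u1 P" "subseq u2 (x @ S)"
    using subseq_append_long_prefix[OF P u(1) True u(3)] .
  have u2: "u2 \<in> lists \<Sigma>" using u12 u(1) by simp
  have "subseq u2 (y @ S)"
  proof (cases "q \<le> length u2")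
    case False
    then have "subseq u2 S" using universal_subseq_le[OF S u2] by simp
    then show ?thesis by (simp add: list_emb_append2)
  next
    case True
    obtain v u3 where v: "u2 = v @ u3" "q \<le> length u3" "subseq v x" "subseq u3 S"
      using subseq_append_long_suffix[OF S u2 True u12(4)] .
    have "length v \<le> d" using u12 v u(2) by simp
    then have "subseq v y" using xy v(3) by (simp add: simon_congruent_iff)
    with v show ?thesis by (simp add: list_emb_append_mono)
  qed
  with u12 show ?thesis by (simp add: list_emb_append_mono)
qed

section \<open>Arches\<close>

lemma is_arch_snocE:
  assumes "is_arch \<Sigma> x"
  obtains s y where "x = s @ [y]" "y \<notin> set s" "\<Sigma> \<subseteq> insert y (set s)"
proof -
  from assms have "x = butlast x @ [last x]" by (simp add: is_arch_def)
  moreover from this have "count_list (butlast x @ [last x]) (last x) = 1"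
    using assms by (simp add: is_arch_def)
  then have "last x \<notin> set (butlast x)" by (simp add: count_list_0_iff)
  moreover have "\<Sigma> \<subseteq> insert (last x) (set (butlast x))"
    using assms calculation(1) unfolding is_arch_def by (metis list.simps(15) rotate1.simps(2) set_rotate1)
  ultimately show ?thesis using that by blast
qed

lemma is_arch_covers: "is_arch \<Sigma> x \<Longrightarrow> \<Sigma> \<subseteq> set x"
  by (simp add: is_arch_def)

text \<open>Prefixing a word missing from \<open>v\<close> with the last letter of the arch gives a
  word missing from \<open>x @ v\<close>: that letter first occurs at the end of \<open>x\<close>,
  so matching it uses up the whole arch.\<close>

lemma not_universal_arch_append:
  assumes "is_arch \<Sigma> x" "set x \<subseteq> \<Sigma>" "\<not> universal \<Sigma> l v"
  shows "\<not> universal \<Sigma> (Suc l) (x @ v)"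
proof -
  obtain s y where x: "x = s @ [y]" "y \<notin> set s" using is_arch_snocE[OF assms(1)] by metis
  obtain u where u: "u \<in> lists \<Sigma>" "length u = l" "\<not> subseq u v"
    using assms(3) unfolding universal_def by blast
  have "\<not> subseq (y # u) (x @ v)" using u x by (simp add: subseq_Cons_first_occurrence)
  moreover have "y # u \<in> lists \<Sigma>" using u x assms(2) by simp
  ultimately show ?thesis using u(2) unfolding universal_def by (metis length_Cons)
qed

lemma arches_universal_iff:
  assumes "\<forall>x \<in> set xs. is_arch \<Sigma> x" "\<not> \<Sigma> \<subseteq> set r" "concat xs @ r \<in> lists \<Sigma>"
  shows "universal \<Sigma> l (concat xs @ r) \<longleftrightarrow> l \<le> length xs"
proof -
  have "universal \<Sigma> (length xs) (concat xs @ r)"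
    using assms(1)
  proof (induction xs)
    case (Cons x xs)
    then show ?case
      using universal_append[OF universal_1[OF is_arch_covers], of \<Sigma> x "length xs" "concat xs @ r"] by simp
  qed simp
  moreover have "\<not> universal \<Sigma> (Suc (length xs)) (concat xs @ r)"
    using assms
  proof (induction xs)
    case Nil
    then obtain c where "c \<in> \<Sigma>" "c \<notin> set r" by blast
    then show ?case by (auto simp: universal_def subseq_singleton_left intro!: bexI[of _ "[c]"])
  next
    case (Cons x xs)
    then have "\<not> universal \<Sigma> (Suc (length xs)) (concat xs @ r)" by simp
    moreover have "set x \<subseteq> \<Sigma>" using Cons.prems(3) by (auto simp: in_lists_conv_set)
    ultimately show ?case using not_universal_arch_append[of \<Sigma> x] Cons.prems(1) by simp
  qed
  ultimately show ?thesis by (meson not_less_eq_eq universal_mono)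
qed

lemma arch_factorization_works:
  assumes "\<Sigma> \<noteq> {}" "w \<in> lists \<Sigma>"
  shows "is_arch_factorization \<Sigma> w (arch_factorization \<Sigma> w)"
  unfolding arch_factorization_def by (rule theI'[OF arch_factorization_ex1[OF assms]])

lemma universal_iff_le_arches:
  assumes "\<Sigma> \<noteq> {}" "w \<in> lists \<Sigma>"
  shows "universal \<Sigma> l w \<longleftrightarrow> l \<le> length (fst (arch_factorization \<Sigma> w))"
  using arch_factorization_works[OF assms] arches_universal_iff assms(2)
  unfolding is_arch_factorization_def by metis

text \<open>The number of arches attains the maximum, so the \<open>GREATEST\<close> in
  \<open>iota\<close> is well defined.\<close>

lemma universal_iff_le_iota:
  assumes "\<Sigma> \<noteq> {}" "w \<in> lists \<Sigma>"
  shows "universal \<Sigma> l w \<longleftrightarrow> l \<le> iota \<Sigma> w"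
proof -
  have "iota \<Sigma> w = (GREATEST l. universal \<Sigma> l w)"
    by (simp add: iota_def universal_def)
  also have "\<dots> = length (fst (arch_factorization \<Sigma> w))"
    by (rule Greatest_equality) (simp_all add: universal_iff_le_arches[OF assms])
  finally show ?thesis using universal_iff_le_arches[OF assms] by simp
qed

lemma length_arch_factorization:
  assumes "\<Sigma> \<noteq> {}" "w \<in> lists \<Sigma>"
  shows "length (fst (arch_factorization \<Sigma> w)) = iota \<Sigma> w"
  using universal_iff_le_arches[OF assms] universal_iff_le_iota[OF assms] by (meson order.antisym order.refl)

lemma iota_rev:
  assumes "\<Sigma> \<noteq> {}" "w \<in> lists \<Sigma>"
  shows "iota \<Sigma> (rev w) = iota \<Sigma> w"
proof -
  have "rev w \<in> lists \<Sigma>" using assms(2) by (simp add: in_lists_conv_set)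
  then have "l \<le> iota \<Sigma> (rev w) \<longleftrightarrow> l \<le> iota \<Sigma> w" for l
    using universal_iff_le_iota[OF assms(1)] assms(2) universal_rev by metis
  then show ?thesis by (meson order.antisym order.refl)
qed

lemma is_arch_ar:
  assumes "\<Sigma> \<noteq> {}" "w \<in> lists \<Sigma>" "1 \<le> i" "i \<le> iota \<Sigma> w"
  shows "is_arch \<Sigma> (ar \<Sigma> i w)"
  using arch_factorization_works[OF assms(1,2)] length_arch_factorization[OF assms(1,2)] assms(3,4)
  unfolding ar_def is_arch_factorization_def by auto

lemma not_covers_re:
  assumes "\<Sigma> \<noteq> {}" "w \<in> lists \<Sigma>"
  shows "\<not> \<Sigma> \<subseteq> set (re \<Sigma> w)"
  using arch_factorization_works[OF assms] unfolding re_def is_arch_factorization_def by blast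

section \<open>The \<open>\<alpha>\<close>-\<open>\<beta>\<close>-factorization\<close>

text \<open>The recursion peels off the first arch and shifts the index functions, which suits
  induction on the number of arches.\<close>

fun ab_word :: "nat \<Rightarrow> (nat \<Rightarrow> 'a list) \<Rightarrow> (nat \<Rightarrow> 'a list) \<Rightarrow> 'a list" where
  "ab_word 0 \<alpha> \<beta> = \<alpha> 0"
| "ab_word (Suc m) \<alpha> \<beta> = \<alpha> 0 @ \<beta> 1 @ ab_word m (\<lambda>i. \<alpha> (Suc i)) (\<lambda>i. \<beta> (Suc i))"

lemma ab_word_conv_concat:
  "ab_word m \<alpha> \<beta> = \<alpha> 0 @ concat (map (\<lambda>i. \<beta> i @ \<alpha> i) [1..<Suc m])"
proof (induction m arbitrary: \<alpha> \<beta>)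
  case (Suc m)
  have "[1..<Suc (Suc m)] = 1 # map Suc [1..<Suc m]"
    by (simp only: map_Suc_upt) (simp add: upt_conv_Cons)
  then show ?case by (simp add: Suc.IH comp_def del: upt_Suc)
qed simp

text \<open>Unlike the \<open>\<alpha>\<close>-\<open>\<beta>\<close>-factorization itself, this condition is local, hence stable under
  dropping \<open>\<alpha> 0\<close> and \<open>\<beta> 1\<close>.\<close>

definition ab_arches :: "'a set \<Rightarrow> nat \<Rightarrow> (nat \<Rightarrow> 'a list) \<Rightarrow> (nat \<Rightarrow> 'a list) \<Rightarrow> bool" where
  "ab_arches \<Sigma> m \<alpha> \<beta> \<longleftrightarrow>
     (\<forall>i<m. is_arch \<Sigma> (\<alpha> i @ \<beta> (Suc i)) \<and> is_arch \<Sigma> (rev (\<beta> (Suc i) @ \<alpha> (Suc i))) \<and> \<beta> (Suc i) \<noteq> []) \<and>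
     \<not> \<Sigma> \<subseteq> set (\<alpha> m) \<and> set (ab_word m \<alpha> \<beta>) \<subseteq> \<Sigma>"

lemma ab_arches_SucD:
  assumes "ab_arches \<Sigma> (Suc m) \<alpha> \<beta>"
  shows "is_arch \<Sigma> (\<alpha> 0 @ \<beta> 1)" "is_arch \<Sigma> (rev (\<beta> 1 @ \<alpha> 1))" "\<beta> 1 \<noteq> []"
    "ab_arches \<Sigma> m (\<lambda>i. \<alpha> (Suc i)) (\<lambda>i. \<beta> (Suc i))"
    "set (\<alpha> 0) \<subseteq> \<Sigma>" "set (\<beta> 1) \<subseteq> \<Sigma>"
  using assms by (auto simp: ab_arches_def)

lemma ab_factorization_arches:
  assumes "\<Sigma> \<noteq> {}" "w \<in> lists \<Sigma>" "is_alpha_beta_factorization \<Sigma> w \<alpha> \<beta>" "m = iota \<Sigma> w"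
  shows "w = ab_word m \<alpha> \<beta>" "ab_arches \<Sigma> m \<alpha> \<beta>"
proof -
  note f = assms(3)[unfolded is_alpha_beta_factorization_def, folded assms(4)]
  show w: "w = ab_word m \<alpha> \<beta>" unfolding ab_word_conv_concat using f by blast
  have "ar \<Sigma> i w = \<alpha> (i - 1) @ \<beta> i \<and> ra \<Sigma> i w = \<beta> i @ \<alpha> i" if "i \<in> {1..m}" for i
    using f that by blast
  from this[of "Suc _"] have ar: "ar \<Sigma> (Suc i) w = \<alpha> i @ \<beta> (Suc i)"
    and ra: "ra \<Sigma> (Suc i) w = \<beta> (Suc i) @ \<alpha> (Suc i)" if "i < m" for i
    using that by simp_all
  have rw: "rev w \<in> lists \<Sigma>" using assms(2) by (simp add: in_lists_conv_set)
  have arch: "is_arch \<Sigma> (\<alpha> i @ \<beta> (Suc i))" if "i < m" for i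
    using is_arch_ar[OF assms(1,2), of "Suc i"] ar[OF that] that assms(4) by simp
  have rarch: "is_arch \<Sigma> (rev (\<beta> (Suc i) @ \<alpha> (Suc i)))" if "i < m" for i
  proof -
    have "ar \<Sigma> (m - Suc i + 1) (rev w) = rev (\<beta> (Suc i) @ \<alpha> (Suc i))"
      using ra[OF that] unfolding ra_def assms(4)[symmetric] by (metis rev_rev_ident)
    then show ?thesis
      using is_arch_ar[OF assms(1) rw, of "m - Suc i + 1"] that assms(4) iota_rev[OF assms(1,2)] by simp
  qed
  have "\<alpha> m = re \<Sigma> w" using f by blast
  then have am: "\<not> \<Sigma> \<subseteq> set (\<alpha> m)" using not_covers_re[OF assms(1,2)] by simp
  \<comment> \<open>Downward induction from \<open>\<alpha> m\<close>, the rest of \<open>w\<close>.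
    If \<open>\<alpha> (Suc n)\<close> misses a letter, then \<open>\<beta> (Suc n)\<close> is
    nonempty because the two together cover \<open>\<Sigma>\<close>; hence \<open>\<alpha> n\<close>
    is a proper prefix of an arch and misses its last letter.\<close>
  have nc: "\<not> \<Sigma> \<subseteq> set (\<alpha> i)" if "i \<le> m" for i
    using that
  proof (induction i rule: inc_induct)
    case base
    show ?case by (rule am)
  next
    case (step n)
    have "\<beta> (Suc n) \<noteq> []" using is_arch_covers[OF rarch[OF step.hyps(2)]] step.IH by auto
    moreover obtain s y where s: "\<alpha> n @ \<beta> (Suc n) = s @ [y]" "y \<notin> set s"
      using is_arch_snocE[OF arch[OF step.hyps(2)]] by metis
    ultimately have "set (\<alpha> n) \<subseteq> set s"
      by (cases "\<beta> (Suc n)" rule: rev_cases) auto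
    \<comment> \<open>\<open>is_arch\<close> does not confine the letters of an arch to
      \<open>\<Sigma>\<close>; here they lie there because the arch is a factor of
      \<open>w\<close>.\<close>
    moreover have "y \<in> \<Sigma>"
    proof -
      have "\<alpha> n @ \<beta> (Suc n) = ar \<Sigma> (Suc n) w" using ar[OF step.hyps(2)] by simp
      also have "\<dots> \<in> set (fst (arch_factorization \<Sigma> w))"
        unfolding ar_def using step.hyps length_arch_factorization[OF assms(1,2)] assms(4) by simp
      finally have "set (\<alpha> n @ \<beta> (Suc n)) \<subseteq> set w"
        using arch_factorization_works[OF assms(1,2)] unfolding is_arch_factorization_def
        by (metis (no_types, lifting) UN_upper le_supI1 set_append set_concat)
      then show ?thesis using s(1) assms(2) by auto
    qed
    ultimately show ?case using s(2) by blast
  qed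
  have "\<beta> (Suc i) \<noteq> []" if "i < m" for i
    using is_arch_covers[OF rarch[OF that]] nc[of "Suc i"] that by auto
  with arch rarch am w assms(2) show "ab_arches \<Sigma> m \<alpha> \<beta>" unfolding ab_arches_def by auto
qed

text \<open>After \<open>\<alpha> 0\<close> come \<open>m\<close> blocks
  \<open>\<beta> i @ \<alpha> i\<close>, each a reversed arch and so covering
  \<open>\<Sigma>\<close>.\<close>

lemma ab_word_universal_suffix:
  assumes "ab_arches \<Sigma> m \<alpha> \<beta>"
  obtains T where "ab_word m \<alpha> \<beta> = \<alpha> 0 @ T" "universal \<Sigma> m T"
  using assms
proof (induction m arbitrary: \<alpha> \<beta> thesis)
  case (Suc m)
  note s = ab_arches_SucD[OF Suc.prems(2)]
  obtain T where T: "ab_word m (\<lambda>i. \<alpha> (Suc i)) (\<lambda>i. \<beta> (Suc i)) = \<alpha> (Suc 0) @ T" "universal \<Sigma> m T"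
    using Suc.IH[OF _ s(4)] by blast
  have "universal \<Sigma> (1 + m) ((\<beta> 1 @ \<alpha> 1) @ T)"
    by (rule universal_append[OF universal_1 T(2)]) (use is_arch_covers[OF s(2)] in auto)
  then show ?case using Suc.prems(1)[of "\<beta> 1 @ \<alpha> 1 @ T"] T(1) by simp
qed simp

lemma not_universal_ab_word:
  assumes "ab_arches \<Sigma> m \<alpha> \<beta>"
  shows "\<not> universal \<Sigma> (Suc m) (ab_word m \<alpha> \<beta>)"
  using assms
proof (induction m arbitrary: \<alpha> \<beta>)
  case 0
  then show ?case using arches_universal_iff[of "[]" \<Sigma> "\<alpha> 0"] by (auto simp: ab_arches_def)
next
  case (Suc m)
  note s = ab_arches_SucD[OF Suc.prems]
  show ?case using not_universal_arch_append[OF s(1) _ Suc.IH[OF s(4)]] s(5,6) by simp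
qed

text \<open>\<open>P\<close> collects the part already exchanged. Each step replaces
  \<open>\<alpha> 0\<close> between \<open>P\<close> and a universal suffix, then moves one arch
  into \<open>P\<close>: \<open>p\<close> grows by one as \<open>m\<close> drops by one, so the
  bound \<open>p + m + d\<close> is preserved.\<close>

lemma subseq_ab_word_replace:
  assumes "ab_arches \<Sigma> m \<alpha> \<beta>" "ab_arches \<Sigma> m \<alpha>' \<beta>'" "\<forall>i<m. \<beta> (Suc i) = \<beta>' (Suc i)"
    "\<forall>i\<le>m. simon_congruent d (\<alpha> i) (\<alpha>' i)" "universal \<Sigma> p P" "u \<in> lists \<Sigma>"
    "length u \<le> p + m + d" "subseq u (P @ ab_word m \<alpha> \<beta>)"
  shows "subseq u (P @ ab_word m \<alpha>' \<beta>')"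
  using assms
proof (induction m arbitrary: \<alpha> \<beta> \<alpha>' \<beta>' P p)
  case 0
  then show ?case using subseq_replace_between_universal[of \<Sigma> p P 0 "[]" d "\<alpha> 0" "\<alpha>' 0" u] by simp
next
  case (Suc m)
  note s = ab_arches_SucD[OF Suc.prems(1)] and s' = ab_arches_SucD[OF Suc.prems(2)]
  obtain T where T: "ab_word (Suc m) \<alpha> \<beta> = \<alpha> 0 @ T" "universal \<Sigma> (Suc m) T"
    using ab_word_universal_suffix[OF Suc.prems(1)] .
  have "subseq u (P @ \<alpha>' 0 @ T)"
    using subseq_replace_between_universal[OF Suc.prems(5) T(2), of d "\<alpha> 0" "\<alpha>' 0" u] Suc.prems T(1) by simp
  then have "subseq u ((P @ \<alpha>' 0 @ \<beta>' 1) @ ab_word m (\<lambda>i. \<alpha> (Suc i)) (\<lambda>i. \<beta> (Suc i)))"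
    using T(1) Suc.prems(3) by simp
  moreover have "universal \<Sigma> (p + 1) (P @ \<alpha>' 0 @ \<beta>' 1)"
    using universal_append[OF Suc.prems(5) universal_1[OF is_arch_covers[OF s'(1)]]] .
  ultimately have "subseq u ((P @ \<alpha>' 0 @ \<beta>' 1) @ ab_word m (\<lambda>i. \<alpha>' (Suc i)) (\<lambda>i. \<beta>' (Suc i)))"
    using Suc.prems(3,4,6,7) by (intro Suc.IH[OF s(4) s'(4)]) auto
  then show ?case by simp
qed

lemma ab_word_congruentI:
  assumes "ab_arches \<Sigma> m \<alpha> \<beta>" "ab_arches \<Sigma> m \<alpha>' \<beta>'" "\<forall>i<m. \<beta> (Suc i) = \<beta>' (Suc i)"
    "\<forall>i\<le>m. simon_congruent d (\<alpha> i) (\<alpha>' i)"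
  shows "simon_congruent (m + d) (ab_word m \<alpha> \<beta>) (ab_word m \<alpha>' \<beta>')"
proof -
  have *: "subseq u (ab_word m \<alpha>' \<beta>')" if "ab_arches \<Sigma> m \<alpha> \<beta>" "ab_arches \<Sigma> m \<alpha>' \<beta>'"
    "\<forall>i<m. \<beta> (Suc i) = \<beta>' (Suc i)" "\<forall>i\<le>m. simon_congruent d (\<alpha> i) (\<alpha>' i)"
    "length u \<le> m + d" "subseq u (ab_word m \<alpha> \<beta>)" for u and \<alpha> \<beta> \<alpha>' \<beta>' :: "nat \<Rightarrow> 'a list"
  proof -
    have "u \<in> lists \<Sigma>" using subseq_set[OF that(6)] that(1) by (auto simp: ab_arches_def)
    then show ?thesis using subseq_ab_word_replace[OF that(1-4), of 0 "[]" u] that(5,6) by simp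
  qed
  show ?thesis unfolding simon_congruent_iff
    using *[of \<alpha> \<beta> \<alpha>' \<beta>'] *[of \<alpha>' \<beta>' \<alpha> \<beta>] assms simon_congruent_sym by metis
qed

text \<open>The first letters of the \<open>\<beta>\<close> factors act as a marker for the end of
  \<open>\<alpha> 0\<close>. By induction the later ones keep \<open>u\<close> and the first marker
  inside \<open>\<alpha> 0 @ \<beta> 1 @ \<alpha> 1\<close>, and there the last occurrence of that
  marker is the start of \<open>\<beta> 1\<close>.\<close>

lemma subseq_append_heads_ab_word:
  assumes "ab_arches \<Sigma> m \<alpha> \<beta>"
  shows "subseq (u @ map (\<lambda>i. hd (\<beta> (Suc i))) [0..<m]) (ab_word m \<alpha> \<beta>) \<longleftrightarrow> subseq u (\<alpha> 0)"
  using assms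
proof (induction m arbitrary: \<alpha> \<beta> u)
  case (Suc m)
  note s = ab_arches_SucD[OF Suc.prems]
  define W where "W = ab_word m (\<lambda>i. \<alpha> (Suc i)) (\<lambda>i. \<beta> (Suc i))"
  define h where "h = map (\<lambda>i. hd (\<beta> (Suc (Suc i)))) [0..<m]"
  have IH: "subseq (t @ h) W \<longleftrightarrow> subseq t (\<alpha> 1)" for t
    using Suc.IH[OF s(4)] by (simp add: W_def h_def)
  obtain c r where c: "\<beta> 1 = c # r" using s(3) by (cases "\<beta> 1") auto
  \<comment> \<open>The head of \<open>\<beta> 1\<close> is the last letter of the reversed arch,
    hence unique in \<open>\<beta> 1 @ \<alpha> 1\<close>.\<close>
  obtain s0 y where "rev (\<beta> 1 @ \<alpha> 1) = s0 @ [y]" "y \<notin> set s0" using is_arch_snocE[OF s(2)] by metis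
  then have "c # r @ \<alpha> 1 = y # rev s0" "y \<notin> set s0" using c by (simp_all add: rev_swap del: rev_append)
  then have cn: "c \<notin> set (r @ \<alpha> 1)" by simp
  have "[0..<Suc m] = 0 # map Suc [0..<m]" by (simp only: map_Suc_upt) (simp add: upt_conv_Cons)
  then have "map (\<lambda>i. hd (\<beta> (Suc i))) [0..<Suc m] = c # h" using c by (simp add: h_def del: upt_Suc)
  moreover have "subseq (u @ c # h) (\<alpha> 0 @ c # r @ W) \<longleftrightarrow> subseq u (\<alpha> 0)"
  proof
    assume "subseq u (\<alpha> 0)"
    moreover have "subseq h W" using IH[of "[]"] by simp
    then have "subseq (c # h) (c # r @ W)" by (simp add: list_emb_append2)
    ultimately show "subseq (u @ c # h) (\<alpha> 0 @ c # r @ W)" by (rule list_emb_append_mono)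
  next
    assume "subseq (u @ c # h) (\<alpha> 0 @ c # r @ W)"
    then have "subseq ((u @ [c]) @ h) ((\<alpha> 0 @ c # r) @ W)" by simp
    then obtain v1 v2 where v: "(u @ [c]) @ h = v1 @ v2" "subseq v1 (\<alpha> 0 @ c # r)" "subseq v2 W"
      by (rule subseq_appendE)
    \<comment> \<open>Either a final piece \<open>t\<close> of \<open>u @ [c]\<close> spills into
      \<open>W\<close>, where the induction hypothesis confines it to \<open>\<alpha> 1\<close>, or
      \<open>u @ [c]\<close> already fits before \<open>W\<close>.\<close>
    from v(1) obtain t where "u @ [c] = v1 @ t \<and> v2 = t @ h \<or> v1 = (u @ [c]) @ t \<and> h = t @ v2"
      using append_eq_append_conv2[THEN iffD1, OF v(1)] by metis
    then have "subseq (u @ [c]) ((\<alpha> 0 @ c # r) @ \<alpha> 1)"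
    proof
      assume t: "u @ [c] = v1 @ t \<and> v2 = t @ h"
      then have "subseq t (\<alpha> 1)" using v(3) IH by simp
      with t v(2) show ?thesis by (simp add: list_emb_append_mono del: append_assoc)
    next
      assume "v1 = (u @ [c]) @ t \<and> h = t @ v2"
      then have "subseq (u @ [c]) v1" by (metis list_emb_prefix subseq_order.order_refl)
      then show ?thesis using v(2) by (meson list_emb_prefix subseq_order.order_trans)
    qed
    then show "subseq u (\<alpha> 0)" using subseq_snoc_last_occurrence[OF cn] by simp
  qed
  ultimately show ?case using c by (simp add: W_def del: upt_Suc)
qed simp

text \<open>Equal \<open>\<beta>\<close> factors give both words the same \<open>m\<close> markers,
  so a test word of length at most \<open>d\<close> for \<open>\<alpha> 0\<close> becomes one of
  length at most \<open>m + d\<close> for the whole word.\<close>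

lemma ab_word_congruent_first:
  assumes "ab_arches \<Sigma> m \<alpha> \<beta>" "ab_arches \<Sigma> m \<alpha>' \<beta>'" "\<forall>i<m. \<beta> (Suc i) = \<beta>' (Suc i)"
    "simon_congruent (m + d) (ab_word m \<alpha> \<beta>) (ab_word m \<alpha>' \<beta>')"
  shows "simon_congruent d (\<alpha> 0) (\<alpha>' 0)"
  unfolding simon_congruent_iff
proof (intro allI impI)
  fix u :: "'a list" assume u: "length u \<le> d"
  define h where "h = map (\<lambda>i. hd (\<beta> (Suc i))) [0..<m]"
  have h': "h = map (\<lambda>i. hd (\<beta>' (Suc i))) [0..<m]" using assms(3) by (simp add: h_def)
  have "subseq (u @ h) (ab_word m \<alpha> \<beta>) = subseq (u @ h) (ab_word m \<alpha>' \<beta>')"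
    using assms(4) u by (simp add: simon_congruent_iff h_def)
  then show "subseq u (\<alpha> 0) = subseq u (\<alpha>' 0)"
    using subseq_append_heads_ab_word[OF assms(1), of u] subseq_append_heads_ab_word[OF assms(2), of u]
    by (simp flip: h_def h')
qed

section \<open>The binary alphabet\<close>

text \<open>The arch ends in its only \<open>y\<close>, so before it \<open>\<beta>\<close> has only
  copies of \<open>z\<close>. The first letter of \<open>\<beta>\<close> is unique in
  \<open>\<beta> @ \<alpha>\<close>, which allows at most one \<open>z\<close> and then none in
  \<open>\<alpha>\<close>; if \<open>\<beta>\<close> has no \<open>z\<close>, covering forces one
  into \<open>\<alpha>\<close>.\<close>

lemma binary_beta_eq:
  assumes "y \<noteq> z" "is_arch {y, z} (x @ \<beta>)" "is_arch {y, z} (rev (\<beta> @ \<alpha>))" "\<beta> \<noteq> []"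
    "set \<beta> \<subseteq> {y, z}" "last \<beta> = y"
  shows "\<beta> = (if z \<in> set \<alpha> then [y] else [z, y])"
proof -
  obtain s where s: "\<beta> = s @ [y]" using assms(4,6) by (metis append_butlast_last_id)
  obtain s1 y1 where "x @ \<beta> = s1 @ [y1]" "y1 \<notin> set s1" using is_arch_snocE[OF assms(2)] by metis
  then have "y \<notin> set s" using s by auto
  then have sz: "set s \<subseteq> {z}" using s assms(5) by auto
  obtain s2 c where s2: "rev (\<beta> @ \<alpha>) = s2 @ [c]" "c \<notin> set s2" "{y, z} \<subseteq> insert c (set s2)"
    using is_arch_snocE[OF assms(3)] by metis
  then have ba: "\<beta> @ \<alpha> = c # rev s2" by (simp del: rev_append add: rev_swap)
  show ?thesis
  proof (cases s)
    case Nil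
    then have "z \<in> set \<alpha>" using ba s s2 assms(1) by auto
    with Nil s show ?thesis by simp
  next
    case (Cons d t)
    then have "d = z" "c = z" using sz ba s by auto
    moreover have "z \<notin> set (t @ [y] @ \<alpha>)"
      using ba s Cons s2(2) calculation by (metis append.assoc append_Cons list.inject set_rev)
    ultimately show ?thesis using sz Cons s by (cases t) auto
  qed
qed

lemma binary_first_arches_not_congruent:
  assumes yz: "y \<noteq> z"
    and s: "y \<notin> set s" "z \<in> set s" "set s \<subseteq> {y, z}" and s': "z \<notin> set s'" "y \<in> set s'" "set s' \<subseteq> {y, z}"
    and v: "universal {y, z} m v" "\<not> universal {y, z} (Suc m) v" and k: "Suc m \<le> k"
  shows "\<not> simon_congruent (Suc k) (s @ y # v) (s' @ z # v')"
proof
  assume c: "simon_congruent (Suc k) (s @ y # v) (s' @ z # v')"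
  \<comment> \<open>Over two letters \<open>s\<close> is a nonempty power of \<open>z\<close> and
    \<open>s'\<close> one of \<open>y\<close>, so each word begins with the letter that ends the
    other's first arch. Cancelling that letter removes a whole arch on one side and a single letter
    on the other.\<close>
  obtain t where t: "s = z # t" using s by (cases s) auto
  obtain t' where t': "s' = y # t'" using s' by (cases s') auto
  have vv': "simon_congruent k v (t' @ z # v')"
    using simon_congruent_cancel[of k s y v "[]" "t' @ z # v'"] c s t' by simp
  have v'v: "simon_congruent k v' (t @ y # v)"
    using simon_congruent_cancel[of k s' z v' "[]" "t @ y # v"] simon_congruent_sym[OF c] s' t by simp
  have "universal {y, z} (1 + m) ((t' @ z # t @ [y]) @ v)"
    by (rule universal_append[OF universal_1 v(1)]) auto
  then have uni: "universal {y, z} (Suc m) ((t' @ [z]) @ t @ y # v)" by simp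
  have "universal {y, z} (Suc m) v"
    unfolding universal_def
  proof (intro ballI impI)
    fix u assume u: "u \<in> lists {y, z}" "length u = Suc m"
    then have "subseq u ((t' @ [z]) @ t @ y # v)" using uni unfolding universal_def by blast
    then obtain u1 u2 where u12: "u = u1 @ u2" "subseq u1 (t' @ [z])" "subseq u2 (t @ y # v)"
      by (rule subseq_appendE)
    \<comment> \<open>The two congruences are chained: first the tail \<open>u2\<close> moves from
      \<open>t @ y # v\<close> to \<open>v'\<close>, then all of \<open>u\<close> moves into
      \<open>v\<close>. Both need only length \<open>Suc m\<close>, which is at most
      \<open>k\<close>.\<close>
    then have "subseq u2 v'"
      using simon_congruent_subseq[OF simon_congruent_sym[OF v'v], of u2] u(2) k by simp
    then have "subseq u ((t' @ [z]) @ v')" unfolding u12(1) by (rule list_emb_append_mono[OF u12(2)])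
    then show "subseq u v"
      using simon_congruent_subseq[OF simon_congruent_sym[OF vv'], of u] u(2) k by simp
  qed
  with v(2) show False by blast
qed

text \<open>Cancelling the first arch lowers \<open>m\<close> and the length bound
  \<open>m + d\<close> together, so \<open>d\<close> stays fixed through the induction.\<close>

lemma binary_ab_word_congruentD:
  assumes "\<Sigma> = {a, b}" "a \<noteq> b" "0 < d" "ab_arches \<Sigma> m \<alpha> \<beta>" "ab_arches \<Sigma> m \<alpha>' \<beta>'"
    "simon_congruent (m + d) (ab_word m \<alpha> \<beta>) (ab_word m \<alpha>' \<beta>')"
  shows "(\<forall>i<m. \<beta> (Suc i) = \<beta>' (Suc i)) \<and> (\<forall>i\<le>m. simon_congruent d (\<alpha> i) (\<alpha>' i))"
  using assms(4-)
proof (induction m arbitrary: \<alpha> \<beta> \<alpha>' \<beta>')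
  case (Suc m)
  note p = ab_arches_SucD[OF Suc.prems(1)] and p' = ab_arches_SucD[OF Suc.prems(2)]
  define v where "v = ab_word m (\<lambda>i. \<alpha> (Suc i)) (\<lambda>i. \<beta> (Suc i))"
  define v' where "v' = ab_word m (\<lambda>i. \<alpha>' (Suc i)) (\<lambda>i. \<beta>' (Suc i))"
  obtain s y where s: "\<alpha> 0 @ \<beta> 1 = s @ [y]" "y \<notin> set s" "\<Sigma> \<subseteq> insert y (set s)"
    using is_arch_snocE[OF p(1)] by metis
  obtain s' y' where s': "\<alpha>' 0 @ \<beta>' 1 = s' @ [y']" "y' \<notin> set s'" "\<Sigma> \<subseteq> insert y' (set s')"
    using is_arch_snocE[OF p'(1)] by metis
  have in_\<Sigma>: "set (s @ [y]) \<subseteq> \<Sigma>" "set (s' @ [y']) \<subseteq> \<Sigma>"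
    using p(5,6) p'(5,6) unfolding s(1)[symmetric] s'(1)[symmetric] by simp_all
  have w: "ab_word (Suc m) \<alpha> \<beta> = s @ y # v" "ab_word (Suc m) \<alpha>' \<beta>' = s' @ y' # v'"
    using s(1) s'(1) by (simp_all add: v_def v'_def flip: append_assoc)
  have c: "simon_congruent (Suc (m + d)) (s @ y # v) (s' @ y' # v')"
    using Suc.prems(3) unfolding w by simp
  obtain z where z: "\<Sigma> = {y, z}" "y \<noteq> z" using in_\<Sigma> assms(1,2) by auto
  have "y' = y"
  proof (rule ccontr)
    assume "y' \<noteq> y"
    then have y': "y' = z" using in_\<Sigma>(2) z by auto
    obtain T where "v = \<alpha> 1 @ T" "universal \<Sigma> m T"
      using ab_word_universal_suffix[OF p(4)] by (auto simp: v_def)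
    then have "universal \<Sigma> m v" unfolding universal_def by (auto intro: list_emb_append2)
    moreover have "\<not> universal \<Sigma> (Suc m) v" using not_universal_ab_word[OF p(4)] by (simp add: v_def)
    ultimately show False
      \<comment> \<open>Positivity of \<open>d\<close> supplies
        \<open>Suc m \<le> m + d\<close>.\<close>
      using binary_first_arches_not_congruent[of y z s s' m v "m + d" v'] c s s' in_\<Sigma> z y' assms(3) by auto
  qed
  then have "simon_congruent (m + d) v v'"
    using simon_congruent_cancel[of "m + d" s y v s' v'] c s(2) s'(2) by simp
  note IH = Suc.IH[OF p(4) p'(4), folded v_def v'_def, OF this]
  \<comment> \<open>Congruence for a positive bound determines the letters of
    \<open>\<alpha> 1\<close>; with the common last letter \<open>y\<close> they determine
    \<open>\<beta> 1\<close>.\<close>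
  have "set (\<alpha> 1) = set (\<alpha>' 1)" using simon_congruent_set_eq[OF _ assms(3), of "\<alpha> 1" "\<alpha>' 1"] IH by auto
  moreover have "last (\<beta> 1) = y" "last (\<beta>' 1) = y"
    using s(1) s'(1) p(3) p'(3) \<open>y' = y\<close> by (metis last_appendR last_snoc)+
  ultimately have "\<beta> 1 = \<beta>' 1"
    using binary_beta_eq[OF z(2) p(1-3)[unfolded z(1)]] binary_beta_eq[OF z(2) p'(1-3)[unfolded z(1)]]
      p(6) p'(6) z(1) by simp
  with IH have \<beta>: "\<forall>i<Suc m. \<beta> (Suc i) = \<beta>' (Suc i)" by (auto simp: less_Suc_eq_0_disj)
  \<comment> \<open>This comes last because the markers used to isolate \<open>\<alpha> 0\<close>
    must agree for all \<open>\<beta>\<close> factors.\<close>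
  moreover have "simon_congruent d (\<alpha> 0) (\<alpha>' 0)"
    by (rule ab_word_congruent_first[OF Suc.prems(1,2) \<beta> Suc.prems(3)])
  then have "simon_congruent d (\<alpha> i) (\<alpha>' i)" if "i \<le> Suc m" for i
    using IH that by (cases i) auto
  ultimately show ?case by blast
qed simp

theorem theorem2:
  fixes a b :: 'a and \<Sigma> :: "'a set" and k m :: nat and w w' :: "'a list"
    and \<alpha> \<beta> \<alpha>' \<beta>' :: "nat \<Rightarrow> 'a list"
  assumes "a \<noteq> b" and "\<Sigma> = {a, b}"
    and "w \<in> lists \<Sigma>" and "w' \<in> lists \<Sigma>"
    and "m = iota \<Sigma> w" and "m = iota \<Sigma> w'" and "m < k"
    and "is_alpha_beta_factorization \<Sigma> w \<alpha> \<beta>"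
    and "is_alpha_beta_factorization \<Sigma> w' \<alpha>' \<beta>'"
  shows "simon_congruent k w w' \<longleftrightarrow>
    (\<forall>i \<in> {1..m}. \<beta> i = \<beta>' i) \<and> (\<forall>i \<in> {0..m}. simon_congruent (k - m) (\<alpha> i) (\<alpha>' i))"
proof -
  have "\<Sigma> \<noteq> {}" using assms(2) by simp
  note f = ab_factorization_arches[OF this assms(3,8,5)]
    and f' = ab_factorization_arches[OF this assms(4,9,6)]
  \<comment> \<open>Since \<open>m < k\<close>, the subtraction is exact and
    \<open>d = k - m\<close> is positive, as the forward direction requires.\<close>
  have "m + (k - m) = k" "0 < k - m" using assms(7) by simp_all
  then have "simon_congruent k w w' \<longleftrightarrow>
      (\<forall>i<m. \<beta> (Suc i) = \<beta>' (Suc i)) \<and> (\<forall>i\<le>m. simon_congruent (k - m) (\<alpha> i) (\<alpha>' i))"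
    using binary_ab_word_congruentD[OF assms(2,1) _ f(2) f'(2), of "k - m"]
      ab_word_congruentI[OF f(2) f'(2), of "k - m"]
    by (simp flip: f(1) f'(1)) blast
  moreover have "(\<forall>i<m. \<beta> (Suc i) = \<beta>' (Suc i)) \<longleftrightarrow> (\<forall>i \<in> {1..m}. \<beta> i = \<beta>' i)"
    by (metis Suc_le_eq Suc_pred atLeastAtMost_iff One_nat_def le_add1 plus_1_eq_Suc)
  ultimately show ?thesis by auto
qed

end
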